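(* Let $F_0$ be a surface-knot, let $h_1,\dots,h_g\in P\backslash G(F_0)/P$ be 1-handles attached to $F_0$, let $m_1,n_1,\dots,m_g,n_g$ be integers, and let $(F,\Gamma)=\sum_{j=1}^g h_j(m_j,n_j)$ be the corresponding 2-dimensional braid with repeated pattern over the surface-knot $F=F_0+\sum_{j=1}^g h_j$. Then, by 1-handle moves, $(F,\Gamma)$ is deformed to the form \[ h_1'(m,n_1')+h_2'(0,n_2')+\sum_{j=3}^g h_j'(0,0), \] where $m=\gcd_{1\le j\le g}\{m_j\}$, $h_1',\dots,h_g'\in\langle h_1,\dots,h_g\rangle<P\backslash G(F_0)/P$ (the subgroup generated by $h_1,\dots,h_g$), and $n_1',n_2'$ are integers. (Terms with index larger than $g$ are absent.)
   Context: Surface-knots and 2-dimensional braids. A surface-knot is the image of a smooth embedding of a connected closed oriented surface into $\mathbb{R}^4$. For a surface-knot $F$ let $N(F)=B^2\times F$ be a tubular neighbourhood with projection $p:N(F)\to F$. A 2-dimensional braid over $F$ of degree $N$ is a closed surface $S\subset N(F)$ such that $p|_S$ is a branched covering of degree $N$ and $S\cap p^{-1}(x)$ has $N$ or $N-1$ points for every $x\in F$. Two 2-dimensional braids are equivalent ($\sim$) if an ambient isotopy of $\mathbb{R}^4$ carries one to the other (and the underlying surface-knot to the underlying surface-knot) and is fiber-preserving on the tubular neighbourhood. The standard 2-dimensional braid over $F$ consists of $N$ parallel copies of $F$ obtained from parallel copies of a surface diagram of $F$ in $\mathbb{R}^3$; it determines the standard framing of $N(F)$, and is denoted $(F,\emptyset)$.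 Repeated pattern. Fix an $N$-braid $b$ (the pattern braid). A 2-dimensional braid over $F$ has repeated pattern if every closed path in $F$ presents a power of $b$ with respect to the standard framing. Such a braid, denoted $(F,\Gamma)$, where $\Gamma$ is a collection of bands of parallel oriented loops on $F$ each band presenting $b$, is determined by the integer exponents of $b$ on closed curves generating $H_1(F;\mathbb{Z})$. 1-handles. A 1-handle attached to $F_0$ is a 3-ball $h=B^2\times I$ embedded in $\mathbb{R}^4$ meeting $F_0$ exactly in $B^2\times\partial I$; it is assumed orientable and to have the framing whose projection to $\mathbb{R}^3$ is the blackboard framing. $F_0+h=(F_0-\mathrm{Int}B^2\times\partial I)\cup(\partial B^2\times I)$. The oriented core is $C=\{0\}\times I$. Let $G(F_0)=\pi_1(\mathbb{R}^4-\mathrm{Int}N(F_0),x)$ with $x\in\partial N(F_0)$, and let $P$ be the image of $\pi_1(\partial N(F_0),x)$ in $G(F_0)$. Closing up $\overline{C}=\mathrm{cl}(C-N(F_0))$ by paths $\alpha,\beta$ in $\partial N(F_0)$ from $x$ to its initial and terminal points gives the loop $\alpha\overline{C}\beta^{-1}$ and an element of $P\backslash G(F_0)/P$, with which $h$ is identified. Products and inverses of 1-handles (e.g. $hh'$, $h^{-1}$), and the subgroup $\langle h_1,\dots,h_g\rangle$, are formed using the loops in $G(F_0)$ representing the 1-handles. A trivial 1-handle is one represented by $1$; it is denoted $1$. The core loop of $h$ is the projection of $\alpha\overline{C}\beta^{-1}$ to $F_0+h$, oriented as $C$; the cocore is $\partial B^2\times\{0\}$; their base point is their intersection point. Core loops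 of different 1-handles are taken disjoint. Notation. $h(m,n)$ denotes a 1-handle $h$ with chart loops such that the cocore presents $b^m$ and the core loop presents $b^n$. All 1-handles are attached to one fixed 2-disk in $F_0$ that contains no chart edges other than those of the 1-handles. $(F_0,\Gamma_0)+\sum_j h_j(m_j,n_j)$ denotes the resulting 2-dimensional braid over $F_0+\sum_j h_j$; $\sum_j h_j(m_j,n_j)$ means $(F_0,\emptyset)+\sum_j h_j(m_j,n_j)$. 1-handle moves are the following equivalences: $h(m,n)\sim h^{-1}(-m,-n)$; $h(m,n)\sim h(m,n\pm 2m)$; $1(m,n)\sim 1(-n,m)\sim 1(n,-m)$; $h(m,n)+h'(m',n')\sim hh'(m,n+n')+h'(m'-m,n')\sim h'^{-1}h(m,n-n')+h'(m'+m,n')$ (with the special cases $h(0,n)+h'(0,n')\sim hh'(0,n+n')+h'(0,n')\sim h'^{-1}h(0,n-n')+h'(0,n')$ and $h(m,n)+1(m',0)\sim h(m,n)+1(m'\pm m,0)$); $h(0,n)+h'(m',n')\sim h(0,n\pm m')+h'(m',n')$. *)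

theory Defs
  imports
    "HOL-Analysis.Analysis"
    "HOL-Algebra.Generated_Groups"
    "HOL-Library.Multiset"
begin

section \<open>Surface-knots\<close>

text \<open>\<open>Ck_on\<close> and \<open>smooth_on\<close> are only meant for open sets \<open>S\<close>, since the
  derivatives are taken in the full neighbourhood filter \<open>at x\<close>.\<close>

primrec Ck_on ::
  "nat \<Rightarrow> 'a::euclidean_space set \<Rightarrow> ('a \<Rightarrow> 'b::euclidean_space) \<Rightarrow> bool" where
  "Ck_on 0 S f \<longleftrightarrow> continuous_on S f"
| "Ck_on (Suc k) S f \<longleftrightarrow>
     (\<forall>x\<in>S. f differentiable (at x)) \<and>
     (\<forall>v. Ck_on k S (\<lambda>x. frechet_derivative f (at x) v))"

definition smooth_on ::
  "'a::euclidean_space set \<Rightarrow> ('a \<Rightarrow> 'b::euclidean_space) \<Rightarrow> bool" where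
  "smooth_on S f \<longleftrightarrow> (\<forall>k. Ck_on k S f)"

text \<open>A smooth local parametrization of the subset \<open>F\<close> of 4-space: an injective immersion
  of an open subset of the plane that is a homeomorphism onto a relatively open subset of \<open>F\<close>.\<close>

definition surface_chart ::
  "(real^4) set \<Rightarrow> (real^2) set \<Rightarrow> (real^2 \<Rightarrow> real^4) \<Rightarrow> bool" where
  "surface_chart F V \<phi> \<longleftrightarrow>
     open V \<and> smooth_on V \<phi> \<and>
     (\<forall>u\<in>V. inj (frechet_derivative \<phi> (at u))) \<and>
     (\<exists>U. open U \<and> \<phi> ` V = F \<inter> U) \<and>
     (\<exists>\<psi>. homeomorphism V (\<phi> ` V) \<phi> \<psi>)"

text \<open>Two charts induce the same orientation where they overlap: at a common point, the
  linear map \<open>L\<close> below is the derivative of the transition map.\<close>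

definition coherently_oriented ::
  "(real^2) set \<Rightarrow> (real^2 \<Rightarrow> real^4) \<Rightarrow> (real^2) set \<Rightarrow> (real^2 \<Rightarrow> real^4) \<Rightarrow> bool" where
  "coherently_oriented V \<phi> W \<psi> \<longleftrightarrow>
     (\<forall>u\<in>V. \<forall>w\<in>W. \<phi> u = \<psi> w \<longrightarrow>
        (\<exists>L. linear L \<and> det (matrix L) > 0 \<and>
             frechet_derivative \<phi> (at u) = frechet_derivative \<psi> (at w) \<circ> L))"

text \<open>The image of a smooth embedding of a closed connected oriented surface into 4-space,
  i.e. a nonempty compact connected smooth 2-dimensional submanifold that has an oriented atlas.\<close>

definition surface_knot :: "(real^4) set \<Rightarrow> bool" where
  "surface_knot F \<longleftrightarrow>
     F \<noteq> {} \<and> compact F \<and> connected F \<and>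
     (\<exists>\<A>. (\<forall>(V, \<phi>)\<in>\<A>. surface_chart F V \<phi>) \<and>
          (\<Union>(V, \<phi>)\<in>\<A>. \<phi> ` V) = F \<and>
          (\<forall>(V, \<phi>)\<in>\<A>. \<forall>(W, \<psi>)\<in>\<A>. coherently_oriented V \<phi> W \<psi>))"

text \<open>\<open>N\<close> is the image of a smooth embedding of the product of the closed unit disk with \<open>F\<close>,
  restricting to the identity on the zero section. Smoothness up to the boundary of the disk
  is expressed by letting the embedding extend to a slightly larger open disk.\<close>

definition tubular_neighbourhood :: "(real^4) set \<Rightarrow> (real^4) set \<Rightarrow> bool" where
  "tubular_neighbourhood F N \<longleftrightarrow>
     (\<exists>(\<Phi> :: real^2 \<Rightarrow> real^4 \<Rightarrow> real^4) r.
        r > 1 \<and>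
        inj_on (\<lambda>(z, y). \<Phi> z y) (ball 0 r \<times> F) \<and>
        (\<forall>y\<in>F. \<Phi> 0 y = y) \<and>
        (\<forall>V \<phi>. surface_chart F V \<phi> \<longrightarrow>
           smooth_on (ball 0 r \<times> V) (\<lambda>(z, u). \<Phi> z (\<phi> u)) \<and>
           (\<forall>q\<in>ball 0 r \<times> V. inj (frechet_derivative (\<lambda>(z, u). \<Phi> z (\<phi> u)) (at q)))) \<and>
        N = (\<lambda>(z, y). \<Phi> z y) ` (cball 0 1 \<times> F))"


section \<open>The knot group, the peripheral subgroup and 1-handles\<close>

definition based_loops :: "'a::topological_space set \<Rightarrow> 'a \<Rightarrow> (real \<Rightarrow> 'a) set" where
  "based_loops X x =
     {p. path p \<and> path_image p \<subseteq> X \<and> pathstart p = x \<and> pathfinish p = x}"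

definition loop_class :: "'a::topological_space set \<Rightarrow> (real \<Rightarrow> 'a) \<Rightarrow> (real \<Rightarrow> 'a) set" where
  "loop_class X p = {q. homotopic_paths X p q}"

definition fundamental_group ::
  "'a::topological_space set \<Rightarrow> 'a \<Rightarrow> (real \<Rightarrow> 'a) set monoid" where
  "fundamental_group X x =
     \<lparr>carrier = loop_class X ` based_loops X x,
      mult = (\<lambda>A B. \<Union>p\<in>A. \<Union>q\<in>B. loop_class X (p +++ q)),
      one = loop_class X (\<lambda>_. x)\<rparr>"

definition knot_group :: "(real^4) set \<Rightarrow> real^4 \<Rightarrow> (real \<Rightarrow> real^4) set monoid" where
  "knot_group N x = fundamental_group (- interior N) x"

text \<open>The image of the fundamental group of the boundary of \<open>N\<close> in the knot group.\<close>

definition peripheral_subgroup :: "(real^4) set \<Rightarrow> real^4 \<Rightarrow> (real \<Rightarrow> real^4) set set" where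
  "peripheral_subgroup N x = loop_class (- interior N) ` based_loops (frontier N) x"

definition double_coset :: "('a, 'c) monoid_scheme \<Rightarrow> 'a set \<Rightarrow> 'a \<Rightarrow> 'a set" where
  "double_coset G P a = {p \<otimes>\<^bsub>G\<^esub> a \<otimes>\<^bsub>G\<^esub> q | p q. p \<in> P \<and> q \<in> P}"

text \<open>A 1-handle attached to \<open>F\<^sub>0\<close> is identified with an element of this set, for
  \<open>G\<close> the knot group and \<open>P\<close> the peripheral subgroup; an element \<open>a\<close> of a double
  coset \<open>h\<close> is (the class of) a loop representing the 1-handle \<open>h\<close>.\<close>

definition double_cosets :: "('a, 'c) monoid_scheme \<Rightarrow> 'a set \<Rightarrow> 'a set set" where
  "double_cosets G P = double_coset G P ` carrier G"

text \<open>For representing loops \<open>A\<close> of some 1-handles: the 1-handles represented by the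
  elements of the subgroup that these loops generate.\<close>

definition handles_generated_by ::
  "('a, 'c) monoid_scheme \<Rightarrow> 'a set \<Rightarrow> 'a set \<Rightarrow> 'a set set" where
  "handles_generated_by G P A = double_coset G P ` generate G A"


section \<open>2-dimensional braids with repeated pattern and 1-handle moves\<close>

text \<open>The triple \<open>(h, m, n)\<close> stands for \<open>h(m,n)\<close>: the 1-handle \<open>h\<close> whose cocore presents the
  \<open>m\<close>-th and whose core loop presents the \<open>n\<close>-th power of the pattern braid. A multiset of
  such triples stands for the 2-dimensional braid obtained from \<open>(F\<^sub>0,\<emptyset>)\<close> by attaching them;
  a braid with repeated pattern is recorded by these exponents, and the order of
  the 1-handles is immaterial since all are attached to one fixed disk.\<close>

type_synonym 'a handle_sum = "('a set \<times> int \<times> int) multiset"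

text \<open>The moves on the summands they involve. The product and the inverse of 1-handles are
  formed from arbitrary loops \<open>a\<close>, \<open>b\<close> representing them; the trivial 1-handle is the
  double coset of the unit. The moves \<open>h(0,n)+h'(0,n') \<sim> hh'(0,n+n')+h'(0,n')\<close>
  and \<open>h(m,n)+1(m',0) \<sim> h(m,n)+1(m'\<plusminus>m,0)\<close> are instances of the two product moves.\<close>

inductive handle_move ::
  "('a, 'c) monoid_scheme \<Rightarrow> 'a set \<Rightarrow> 'a handle_sum \<Rightarrow> 'a handle_sum \<Rightarrow> bool"
  for G (structure) and P where
  inverse:
    "a \<in> carrier G \<Longrightarrow>
     handle_move G P {#(double_coset G P a, m, n)#}
                     {#(double_coset G P (inv a), - m, - n)#}"
| twist_plus:
    "a \<in> carrier G \<Longrightarrow>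
     handle_move G P {#(double_coset G P a, m, n)#}
                     {#(double_coset G P a, m, n + 2 * m)#}"
| twist_minus:
    "a \<in> carrier G \<Longrightarrow>
     handle_move G P {#(double_coset G P a, m, n)#}
                     {#(double_coset G P a, m, n - 2 * m)#}"
| trivial_rotate_left:
    "handle_move G P {#(double_coset G P \<one>, m, n)#}
                     {#(double_coset G P \<one>, - n, m)#}"
| trivial_rotate_right:
    "handle_move G P {#(double_coset G P \<one>, m, n)#}
                     {#(double_coset G P \<one>, n, - m)#}"
| product_right:
    "a \<in> carrier G \<Longrightarrow> b \<in> carrier G \<Longrightarrow>
     handle_move G P
       {#(double_coset G P a, m, n), (double_coset G P b, m', n')#}
       {#(double_coset G P (a \<otimes> b), m, n + n'), (double_coset G P b, m' - m, n')#}"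
| product_left_inverse:
    "a \<in> carrier G \<Longrightarrow> b \<in> carrier G \<Longrightarrow>
     handle_move G P
       {#(double_coset G P a, m, n), (double_coset G P b, m', n')#}
       {#(double_coset G P (inv b \<otimes> a), m, n - n'), (double_coset G P b, m' + m, n')#}"
| core_plus:
    "a \<in> carrier G \<Longrightarrow> b \<in> carrier G \<Longrightarrow>
     handle_move G P
       {#(double_coset G P a, 0, n), (double_coset G P b, m', n')#}
       {#(double_coset G P a, 0, n + m'), (double_coset G P b, m', n')#}"
| core_minus:
    "a \<in> carrier G \<Longrightarrow> b \<in> carrier G \<Longrightarrow>
     handle_move G P
       {#(double_coset G P a, 0, n), (double_coset G P b, m', n')#}
       {#(double_coset G P a, 0, n - m'), (double_coset G P b, m', n')#}"

text \<open>A finite sequence of moves (in either direction, as they are equivalences), each leaving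
  the remaining 1-handles \<open>R\<close> untouched.\<close>

definition deformed_by_handle_moves ::
  "('a, 'c) monoid_scheme \<Rightarrow> 'a set \<Rightarrow> 'a handle_sum \<Rightarrow> 'a handle_sum \<Rightarrow> bool" where
  "deformed_by_handle_moves G P =
     equivclp (\<lambda>X Y. \<exists>A B R. handle_move G P A B \<and> X = A + R \<and> Y = B + R)"

end

(* A product move changes (m, m') into (m, m' - m) or (m, m' + m) and, at the same time,
   (n, n') into (n + n', n') or (n - n', n'). Hence Euclid's algorithm on the cocore exponents
   leaves their gcd on one handle and 0 on all the others; as long as the cocore exponents are 0,
   the same moves run Euclid's algorithm on the core exponents of those other handles.
   Representing loops are only multiplied and inverted on the way, so they stay in the subgroup
   generated by the initial ones. *)

theory Submission
  imports Defs
begin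

section \<open>The fundamental group and double cosets\<close>

lemma loop_class_eqI: "homotopic_paths X p q \<Longrightarrow> loop_class X p = loop_class X q"
  unfolding loop_class_def by (auto intro: homotopic_paths_trans homotopic_paths_sym)

lemma based_loops_join:
  "p \<in> based_loops X x \<Longrightarrow> q \<in> based_loops X x \<Longrightarrow> p +++ q \<in> based_loops X x"
  by (auto simp: based_loops_def path_image_join)

lemma based_loops_reversepath: "p \<in> based_loops X x \<Longrightarrow> reversepath p \<in> based_loops X x"
  by (auto simp: based_loops_def)

lemma based_loops_const: "x \<in> X \<Longrightarrow> (\<lambda>_. x) \<in> based_loops X x"
  by (auto simp: based_loops_def path_def path_image_def pathstart_def pathfinish_def)

text \<open>The product of two classes is defined as a union over all pairs of representatives.
  Joins of homotopic factors are homotopic, so every set in that union is the same class, and the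
  union is nonempty because \<open>p\<close> and \<open>q\<close> themselves contribute.\<close>

lemma fundamental_group_mult:
  assumes p: "p \<in> based_loops X x" and q: "q \<in> based_loops X x"
  shows "loop_class X p \<otimes>\<^bsub>fundamental_group X x\<^esub> loop_class X q = loop_class X (p +++ q)"
proof -
  have eq: "loop_class X (p' +++ q') = loop_class X (p +++ q)"
    if "p' \<in> loop_class X p" "q' \<in> loop_class X q" for p' q'
  proof -
    have hom: "homotopic_paths X p' p" "homotopic_paths X q' q"
      using that by (auto simp: loop_class_def intro: homotopic_paths_sym)
    then have "pathfinish p' = pathstart q'"
      using p q homotopic_paths_imp_pathfinish[OF hom(1)] homotopic_paths_imp_pathstart[OF hom(2)]
      by (simp add: based_loops_def)
    then show ?thesis
      using hom by (intro loop_class_eqI homotopic_paths_join)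
  qed
  have mem: "p \<in> loop_class X p" "q \<in> loop_class X q"
    using p q by (auto simp: loop_class_def based_loops_def)
  have "loop_class X p \<otimes>\<^bsub>fundamental_group X x\<^esub> loop_class X q
      = (\<Union>p'\<in>loop_class X p. \<Union>q'\<in>loop_class X q. loop_class X (p' +++ q'))"
    by (simp add: fundamental_group_def)
  also have "\<dots> = (\<Union>p'\<in>loop_class X p. \<Union>q'\<in>loop_class X q. loop_class X (p +++ q))"
    by (intro SUP_cong refl eq)
  also have "\<dots> = loop_class X (p +++ q)"
    using mem by blast
  finally show ?thesis .
qed

lemma group_fundamental_group:
  fixes X :: "'a::real_normed_vector set"
  assumes x: "x \<in> X"
  shows "group (fundamental_group X x)"
proof -
  let ?c = "loop_class X" and ?G = "fundamental_group X x"
  have carrier: "carrier ?G = ?c ` based_loops X x"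
    and one: "\<one>\<^bsub>?G\<^esub> = ?c (\<lambda>_. x)"
    by (auto simp: fundamental_group_def)
  \<comment> \<open>The unit is the class of a constant function, while the homotopy laws for units
    and inverses are phrased with \<open>linepath\<close>.\<close>
  have const: "(\<lambda>_. x) = linepath x x"
    by (auto simp: linepath_def algebra_simps simp flip: scaleR_add_left)
  note simps = carrier one fundamental_group_mult based_loops_join based_loops_const[OF x]
    based_loops_reversepath
  show ?thesis
  proof (rule groupI)
    fix A B C assume "A \<in> carrier ?G" "B \<in> carrier ?G" "C \<in> carrier ?G"
    then obtain p q r where pqr: "A = ?c p" "B = ?c q" "C = ?c r"
      and loops: "p \<in> based_loops X x" "q \<in> based_loops X x" "r \<in> based_loops X x"
      by (auto simp: carrier)
    have "homotopic_paths X ((p +++ q) +++ r) (p +++ q +++ r)"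
      using loops by (intro homotopic_paths_sym[OF homotopic_paths_assoc])
        (auto simp: based_loops_def)
    then show "A \<otimes>\<^bsub>?G\<^esub> B \<otimes>\<^bsub>?G\<^esub> C = A \<otimes>\<^bsub>?G\<^esub> (B \<otimes>\<^bsub>?G\<^esub> C)"
      using loops by (simp add: pqr simps loop_class_eqI)
  next
    fix A assume "A \<in> carrier ?G"
    then obtain p where p: "A = ?c p" "p \<in> based_loops X x"
      by (auto simp: carrier)
    have "homotopic_paths X ((\<lambda>_. x) +++ p) p"
      using p(2) homotopic_paths_lid[of p X] by (auto simp: based_loops_def const)
    then show "\<one>\<^bsub>?G\<^esub> \<otimes>\<^bsub>?G\<^esub> A = A"
      using p by (simp add: simps loop_class_eqI)
    have "homotopic_paths X (reversepath p +++ p) (\<lambda>_. x)"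
      using p(2) homotopic_paths_linv[of p X] by (auto simp: based_loops_def const)
    then have "?c (reversepath p) \<otimes>\<^bsub>?G\<^esub> A = \<one>\<^bsub>?G\<^esub>"
      using p by (simp add: simps loop_class_eqI)
    then show "\<exists>B\<in>carrier ?G. B \<otimes>\<^bsub>?G\<^esub> A = \<one>\<^bsub>?G\<^esub>"
      using p by (auto simp: simps)
  qed (auto simp: simps)
qed

lemma fundamental_group_inv:
  fixes X :: "'a::real_normed_vector set"
  assumes x: "x \<in> X" and p: "p \<in> based_loops X x"
  shows "inv\<^bsub>fundamental_group X x\<^esub> loop_class X p = loop_class X (reversepath p)"
proof -
  interpret group "fundamental_group X x"
    by (rule group_fundamental_group[OF x])
  have "homotopic_paths X (reversepath p +++ p) (\<lambda>_. x)"
    using p homotopic_paths_linv[of p X]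
    by (auto simp: based_loops_def linepath_def algebra_simps simp flip: scaleR_add_left)
  then show ?thesis
    using p by (intro inv_equality)
      (auto simp: fundamental_group_mult based_loops_reversepath loop_class_eqI,
       auto simp: fundamental_group_def based_loops_reversepath)
qed

text \<open>Meant for the peripheral subgroup: \<open>X\<close> becomes the complement of the
  interior of \<open>N\<close>, and \<open>Y\<close> its frontier. Only the loops are confined to
  \<open>Y\<close>; the homotopies take place in \<open>X\<close>.\<close>

lemma subgroup_loops_of_subset:
  fixes X :: "'a::real_normed_vector set"
  assumes "x \<in> Y" and "Y \<subseteq> X"
  shows "subgroup (loop_class X ` based_loops Y x) (fundamental_group X x)"
proof -
  have sub: "p \<in> based_loops X x" if "p \<in> based_loops Y x" for p
    using that assms by (auto simp: based_loops_def)
  show ?thesis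
  proof
    show "loop_class X ` based_loops Y x \<subseteq> carrier (fundamental_group X x)"
      using sub by (auto simp: fundamental_group_def)
    show "\<one>\<^bsub>fundamental_group X x\<^esub> \<in> loop_class X ` based_loops Y x"
      using based_loops_const[OF assms(1)] by (auto simp: fundamental_group_def)
  qed (use assms sub in \<open>auto simp: fundamental_group_mult fundamental_group_inv
         based_loops_join based_loops_reversepath\<close>)
qed

text \<open>If a = p c q with p and q in \<open>P\<close>, then c is the product of inv p, a and inv
  q, so either element can be exchanged for the other by absorbing factors into \<open>P\<close>.
  Thus any loop chosen in a 1-handle represents it, and the moves, which are stated for cosets of
  elements, apply.\<close>

lemma (in group) double_coset_eqI:
  assumes P: "subgroup P G" and h: "h \<in> double_cosets G P" and a: "a \<in> h"
  shows "a \<in> carrier G" and "double_coset G P a = h"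
proof -
  have P_carrier: "p \<in> P \<Longrightarrow> p \<in> carrier G" for p
    using subgroup.mem_carrier[OF P] .
  note closed = subgroup.m_closed[OF P] subgroup.m_inv_closed[OF P]
  obtain c where c: "c \<in> carrier G" "h = double_coset G P c"
    using h by (auto simp: double_cosets_def)
  then obtain p q where pq: "p \<in> P" "q \<in> P" "a = p \<otimes> c \<otimes> q"
    using a by (auto simp: double_coset_def)
  then show carr: "a \<in> carrier G"
    using c P_carrier by simp
  have c_eq: "c = inv p \<otimes> a \<otimes> inv q"
    using pq c P_carrier by (simp add: m_assoc inv_solve_left)
  show "double_coset G P a = h"
  proof (intro equalityI subsetI)
    fix y assume "y \<in> double_coset G P a"
    then obtain r s where rs: "r \<in> P" "s \<in> P" "y = r \<otimes> a \<otimes> s"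
      by (auto simp: double_coset_def)
    then have "y = (r \<otimes> p) \<otimes> c \<otimes> (q \<otimes> s)"
      using pq c P_carrier by (simp add: m_assoc)
    then show "y \<in> h"
      unfolding c(2) double_coset_def using rs pq closed(1) by blast
  next
    fix y assume "y \<in> h"
    then obtain r s where rs: "r \<in> P" "s \<in> P" "y = r \<otimes> c \<otimes> s"
      by (auto simp: c(2) double_coset_def)
    then have "y = (r \<otimes> inv p) \<otimes> a \<otimes> (inv q \<otimes> s)"
      unfolding c_eq using pq carr P_carrier by (simp add: m_assoc)
    then show "y \<in> double_coset G P a"
      unfolding double_coset_def using rs pq closed by blast
  qed
qed

section \<open>Euclid's algorithm by handle moves\<close>

lemma deformed_refl: "deformed_by_handle_moves G P X X"
  by (simp add: deformed_by_handle_moves_def)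

lemma deformed_trans [trans]:
  "deformed_by_handle_moves G P X Y \<Longrightarrow> deformed_by_handle_moves G P Y Z \<Longrightarrow>
   deformed_by_handle_moves G P X Z"
  unfolding deformed_by_handle_moves_def by (rule equivclp_trans)

lemma deformed_handle_move: "handle_move G P A B \<Longrightarrow> deformed_by_handle_moves G P A B"
  unfolding deformed_by_handle_moves_def
  by (rule r_into_equivclp, rule exI[of _ A], rule exI[of _ B], rule exI[of _ "{#}"]) simp

lemma deformed_add:
  assumes "deformed_by_handle_moves G P X Y"
  shows "deformed_by_handle_moves G P (X + R) (Y + R)"
proof -
  define r where "r X Y \<longleftrightarrow> (\<exists>A B R. handle_move G P A B \<and> X = A + R \<and> Y = B + R)" for X Y
  have deformed_eq: "deformed_by_handle_moves G P = equivclp r"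
    unfolding deformed_by_handle_moves_def r_def ..
  have r_add: "r (Y' + R) (Z' + R)" if r: "r Y' Z'" for Y' Z'
  proof -
    obtain A B R' where "handle_move G P A B" "Y' = A + R'" "Z' = B + R'"
      using r unfolding r_def by blast
    then show ?thesis
      unfolding r_def by (intro exI[of _ A] exI[of _ B] exI[of _ "R' + R"]) (simp add: add.assoc)
  qed
  show ?thesis
    using assms unfolding deformed_eq
  proof (induction rule: equivclp_induct)
    case base
    show ?case by (rule equivclp_refl)
  next
    case (step Y Z)
    \<comment> \<open>A step of the equivalence closure may use a move in either direction, and
      \<open>r_add\<close> covers both.\<close>
    then have "r (Y + R) (Z + R) \<or> r (Z + R) (Y + R)"
      using r_add by blast
    with step.IH show ?case by (rule equivclp_into_equivclp)
  qed
qed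

text \<open>Handles are tracked by representing group elements, because a double coset determines
  neither the product with another one nor membership of its representatives in a subgroup. Passing
  to double cosets happens only in this image.\<close>

definition handles_of ::
  "('a, 'c) monoid_scheme \<Rightarrow> 'a set \<Rightarrow> ('a \<times> int \<times> int) multiset \<Rightarrow> 'a handle_sum" where
  "handles_of G P M = image_mset (\<lambda>(a, m, n). (double_coset G P a, m, n)) M"

abbreviation deformable ::
  "('a, 'c) monoid_scheme \<Rightarrow> 'a set \<Rightarrow>
   ('a \<times> int \<times> int) multiset \<Rightarrow> ('a \<times> int \<times> int) multiset \<Rightarrow> bool" where
  "deformable G P M M' \<equiv> deformed_by_handle_moves G P (handles_of G P M) (handles_of G P M')"

lemma deformable_add: "deformable G P M M' \<Longrightarrow> deformable G P (M + R) (M' + R)"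
  by (simp add: handles_of_def deformed_add)

section \<open>Euclid's algorithm on two handles, then on arbitrarily many\<close>

context group
begin

text \<open>One division step of Euclid's algorithm with quotient \<open>k\<close>:
  \<open>product_right\<close> is iterated for positive \<open>k\<close>,
  \<open>product_left_inverse\<close> for negative \<open>k\<close>. The cocore exponent changes on
  the second handle but the core exponent on the first, which decides the order of the handles in
  the two gcd lemmas below.\<close>

lemma deformable_product:
  assumes H: "subgroup H G" and ab: "a \<in> H" "b \<in> H"
  shows "\<exists>a'\<in>H. deformable G P {#(a, m, n), (b, m', n')#}
                                 {#(a', m, n + k * n'), (b, m' - k * m, n')#}"
proof (induction k rule: int_induct[where k = 0])
  case base
  show ?case using ab by (auto intro: deformed_refl)
next
  case (step1 k)
  then obtain a' where a': "a' \<in> H" "deformable G P {#(a, m, n), (b, m', n')#}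
      {#(a', m, n + k * n'), (b, m' - k * m, n')#}" by blast
  have "deformable G P {#(a', m, n + k * n'), (b, m' - k * m, n')#}
      {#(a' \<otimes> b, m, n + k * n' + n'), (b, m' - k * m - m, n')#}"
    using a'(1) ab subgroup.mem_carrier[OF H]
    by (auto simp: handles_of_def intro: deformed_handle_move handle_move.product_right)
  from deformed_trans[OF a'(2) this] show ?case
    using a'(1) ab subgroup.m_closed[OF H] by (intro bexI[of _ "a' \<otimes> b"]) (auto simp: algebra_simps)
next
  case (step2 k)
  then obtain a' where a': "a' \<in> H" "deformable G P {#(a, m, n), (b, m', n')#}
      {#(a', m, n + k * n'), (b, m' - k * m, n')#}" by blast
  have "deformable G P {#(a', m, n + k * n'), (b, m' - k * m, n')#}
      {#(inv b \<otimes> a', m, n + k * n' - n'), (b, m' - k * m + m, n')#}"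
    using a'(1) ab subgroup.mem_carrier[OF H]
    by (auto simp: handles_of_def intro: deformed_handle_move handle_move.product_left_inverse)
  from deformed_trans[OF a'(2) this] show ?case
    using a'(1) ab subgroup.m_closed[OF H] subgroup.m_inv_closed[OF H]
    by (intro bexI[of _ "inv b \<otimes> a'"]) (auto simp: algebra_simps)
qed

lemma deformable_inverse:
  assumes "a \<in> carrier G"
  shows "deformable G P {#(a, m, n)#} {#(inv a, - m, - n)#}"
  using assms by (auto simp: handles_of_def intro: deformed_handle_move handle_move.inverse)

lemma deformable_abs_cocore:
  assumes H: "subgroup H G" and a: "a \<in> H"
  shows "\<exists>a'\<in>H. \<exists>n'. deformable G P {#(a, m, n)#} {#(a', \<bar>m\<bar>, n')#}"
proof (cases "m \<ge> 0")
  case True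
  then show ?thesis using a by (auto intro: deformed_refl)
next
  case False
  then show ?thesis
    using deformable_inverse[of a P m n] a subgroup.mem_carrier[OF H] subgroup.m_inv_closed[OF H]
    by auto
qed

text \<open>Induction on the absolute value of the divisor \<open>m'\<close>, following gcd m m' =
  gcd m' (m mod m'). The core exponents change along the way without being controlled, hence the
  existential \<open>k\<close> and \<open>l\<close>.\<close>

lemma deformable_gcd_cocore:
  assumes H: "subgroup H G" and "a \<in> H" "b \<in> H"
  shows "\<exists>a'\<in>H. \<exists>b'\<in>H. \<exists>k l. deformable G P {#(a, m, n), (b, m', n')#}
                                          {#(a', gcd m m', k), (b', 0, l)#}"
  using assms(2,3)
proof (induction "nat \<bar>m'\<bar>" arbitrary: a b m m' n n' rule: less_induct)
  case less
  show ?case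
  proof (cases "m' = 0")
    \<comment> \<open>Here the gcd is the absolute value of \<open>m\<close>, so at most an
      inversion of the first handle remains.\<close>
    case True
    obtain a' k where "a' \<in> H" "deformable G P {#(a, m, n)#} {#(a', \<bar>m\<bar>, k)#}"
      using deformable_abs_cocore[OF H less.prems(1)] by blast
    then have "deformable G P {#(a, m, n), (b, m', n')#} {#(a', gcd m m', k), (b, 0, n')#}"
      using deformable_add[of G P "{#(a, m, n)#}" "{#(a', \<bar>m\<bar>, k)#}" "{#(b, m', n')#}"] True
      by (simp add: add_mset_commute)
    then show ?thesis
      using \<open>a' \<in> H\<close> less.prems(2) by blast
  next
    case False
    \<comment> \<open>The divisor's handle is put first, since a product move subtracts its cocore
      exponent from that of the second. This is also the order in which the induction hypothesis
      needs the pair.\<close>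
    obtain b' where b': "b' \<in> H" "deformable G P {#(b, m', n'), (a, m, n)#}
        {#(b', m', n' + (m div m') * n), (a, m - (m div m') * m', n)#}"
      using deformable_product[OF H less.prems(2,1)] by blast
    have "nat \<bar>m mod m'\<bar> < nat \<bar>m'\<bar>"
      using False by (simp add: abs_mod_less)
    from less.hyps[OF this b'(1) less.prems(1)]
    obtain c d k l where cd: "c \<in> H" "d \<in> H"
      "deformable G P {#(b', m', n' + (m div m') * n), (a, m mod m', n)#}
         {#(c, gcd m' (m mod m'), k), (d, 0, l)#}" by blast
    have "deformable G P {#(a, m, n), (b, m', n')#} {#(c, gcd m m', k), (d, 0, l)#}"
      using deformed_trans[OF b'(2)] cd(3)
      by (simp add: minus_div_mult_eq_mod add_mset_commute gcd_red_int[of m m'])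
    then show ?thesis using cd by blast
  qed
qed

text \<open>When both cocore exponents are 0, product moves keep them 0 and act on the core
  exponents alone, so the same recursion applies to these.\<close>

lemma deformable_gcd_core:
  assumes H: "subgroup H G" and "a \<in> H" "b \<in> H"
  shows "\<exists>a'\<in>H. \<exists>b'\<in>H. deformable G P {#(a, 0, n), (b, 0, n')#}
                                      {#(a', 0, gcd n n'), (b', 0, 0)#}"
  using assms(2,3)
proof (induction "nat \<bar>n'\<bar>" arbitrary: a b n n' rule: less_induct)
  case less
  show ?case
  proof (cases "n' = 0")
    case True
    obtain a' where "a' \<in> H" "deformable G P {#(a, 0, n)#} {#(a', 0, \<bar>n\<bar>)#}"
      using deformable_inverse[of a P 0 n] less.prems(1) subgroup.mem_carrier[OF H]
        subgroup.m_inv_closed[OF H]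
      by (cases "n \<ge> 0") (auto intro: deformed_refl)
    then have "deformable G P {#(a, 0, n), (b, 0, n')#} {#(a', 0, gcd n n'), (b, 0, 0)#}"
      using deformable_add[of G P "{#(a, 0, n)#}" "{#(a', 0, \<bar>n\<bar>)#}" "{#(b, 0, n')#}"] True
      by (simp add: add_mset_commute)
    then show ?thesis
      using \<open>a' \<in> H\<close> less.prems(2) by blast
  next
    case False
    \<comment> \<open>The core exponent is reduced on the first handle, so no swap precedes this
      move and the quotient enters with a minus sign; the swap comes with the induction
      hypothesis.\<close>
    obtain a' where a': "a' \<in> H" "deformable G P {#(a, 0, n), (b, 0, n')#}
        {#(a', 0, n + (- (n div n')) * n'), (b, 0, n')#}"
      using deformable_product[OF H less.prems, of P 0 n 0 n' "- (n div n')"] by auto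
    have "nat \<bar>n mod n'\<bar> < nat \<bar>n'\<bar>"
      using False by (simp add: abs_mod_less)
    from less.hyps[OF this less.prems(2) a'(1)]
    obtain c d where cd: "c \<in> H" "d \<in> H"
      "deformable G P {#(b, 0, n'), (a', 0, n mod n')#}
         {#(c, 0, gcd n' (n mod n')), (d, 0, 0)#}" by blast
    have "deformable G P {#(a, 0, n), (b, 0, n')#} {#(c, 0, gcd n n'), (d, 0, 0)#}"
      using deformed_trans[OF a'(2)] cd(3)
      by (simp add: minus_div_mult_eq_mod add_mset_commute gcd_red_int[of n n'])
    then show ?thesis using cd by blast
  qed
qed

text \<open>Each further handle is merged with the one that carries the gcd so far, which leaves one
  more handle with cocore exponent 0. \<open>R\<close> collects those handles as pairs of a loop and
  a core exponent, and the size equation keeps count of the handles.\<close>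

lemma deformable_Gcd_cocores:
  assumes H: "subgroup H G" and "M \<noteq> {#}" and "fst ` set_mset M \<subseteq> H"
  shows "\<exists>a\<in>H. \<exists>n R. fst ` set_mset R \<subseteq> H \<and> size M = Suc (size R) \<and>
           deformable G P M (add_mset (a, Gcd ((fst \<circ> snd) ` set_mset M), n)
                               (image_mset (\<lambda>(b, k). (b, 0, k)) R))"
  using assms(2,3)
proof (induction M)
  case empty
  then show ?case by simp
next
  case (add t M)
  obtain b m' n' where t: "t = (b, m', n')" and b: "b \<in> H"
    using add.prems by (cases t) auto
  show ?case
  proof (cases "M = {#}")
    case True
    obtain a n where "a \<in> H" "deformable G P {#t#} {#(a, \<bar>m'\<bar>, n)#}"
      using deformable_abs_cocore[OF H b] t by blast
    then show ?thesis
      using True t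
      by (intro bexI[of _ a] exI[of _ n] exI[of _ "{#}"]) auto
  next
    case False
    let ?Z = "image_mset (\<lambda>(b, k). (b, 0, k))" and ?g = "Gcd ((fst \<circ> snd) ` set_mset M)"
    obtain a n R where IH: "a \<in> H" "fst ` set_mset R \<subseteq> H" "size M = Suc (size R)"
      "deformable G P M (add_mset (a, ?g, n) (?Z R))"
      using add False by auto
    obtain a' b' k l where ab: "a' \<in> H" "b' \<in> H"
      "deformable G P {#(b, m', n'), (a, ?g, n)#} {#(a', gcd m' ?g, k), (b', 0, l)#}"
      using deformable_gcd_cocore[OF H b IH(1)] by blast
    have "deformable G P (add_mset t M) ({#(b, m', n'), (a, ?g, n)#} + ?Z R)"
      using deformable_add[OF IH(4), of "{#t#}"] t by simp
    also have "deformable G P ({#(b, m', n'), (a, ?g, n)#} + ?Z R)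
        (add_mset (a', gcd m' ?g, k) (add_mset (b', 0, l) (?Z R)))"
      using deformable_add[OF ab(3), of "?Z R"] t by simp
    finally show ?thesis
      using IH ab t
      by (intro bexI[of _ a'] exI[of _ k] exI[of _ "add_mset (b', l) R"]) auto
  qed
qed

text \<open>The same induction for handles with cocore exponent 0, now merging core exponents. It
  clears the core exponents of all handles but one, which supplies the second term of the normal
  form.\<close>

lemma deformable_Gcd_cores:
  assumes H: "subgroup H G" and "R \<noteq> {#}" and "fst ` set_mset R \<subseteq> H"
  shows "\<exists>a\<in>H. \<exists>n S. set_mset S \<subseteq> H \<and> size R = Suc (size S) \<and>
           deformable G P (image_mset (\<lambda>(b, k). (b, 0, k)) R)
             (add_mset (a, 0, n) (image_mset (\<lambda>b. (b, 0, 0)) S))"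
  using assms(2,3)
proof (induction R)
  case empty
  then show ?case by simp
next
  case (add t R)
  obtain b n' where t: "t = (b, n')" and b: "b \<in> H"
    using add.prems by (cases t) auto
  show ?case
  proof (cases "R = {#}")
    case True
    then show ?thesis
      using t b
      by (intro bexI[of _ b] exI[of _ n'] exI[of _ "{#}"]) (auto intro: deformed_refl)
  next
    case False
    let ?Z = "image_mset (\<lambda>(b, k). (b, 0, k))" and ?O = "image_mset (\<lambda>b. (b, 0, 0))"
    obtain a n S where IH: "a \<in> H" "set_mset S \<subseteq> H" "size R = Suc (size S)"
      "deformable G P (?Z R) (add_mset (a, 0, n) (?O S))"
      using add False by auto
    obtain a' b' where ab: "a' \<in> H" "b' \<in> H"
      "deformable G P {#(b, 0, n'), (a, 0, n)#} {#(a', 0, gcd n' n), (b', 0, 0)#}"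
      using deformable_gcd_core[OF H b IH(1)] by blast
    have "deformable G P (?Z (add_mset t R)) ({#(b, 0, n'), (a, 0, n)#} + ?O S)"
      using deformable_add[OF IH(4), of "{#(b, 0, n')#}"] t by simp
    also have "deformable G P ({#(b, 0, n'), (a, 0, n)#} + ?O S)
        (add_mset (a', 0, gcd n' n) (add_mset (b', 0, 0) (?O S)))"
      using deformable_add[OF ab(3), of "?O S"] by simp
    finally show ?thesis
      using IH ab t
      by (intro bexI[of _ a'] exI[of _ "gcd n' n"] exI[of _ "add_mset b' S"]) auto
  qed
qed

end

text \<open>Numbers the handles left over after both phases; it is applied with \<open>i\<close>
  equal to 3, the first index of the terms with both exponents 0.\<close>

lemma multiset_indexed_by_interval:
  "\<exists>c. S = image_mset c (mset_set {i..<i + size S})"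
proof -
  obtain xs where xs: "mset xs = S"
    using ex_mset by blast
  have "map (\<lambda>j. xs ! (j - i)) [i..<i + length xs] = xs"
    by (rule nth_equalityI) auto
  then have "S = image_mset (\<lambda>j. xs ! (j - i)) (mset [i..<i + length xs])"
    using xs by (metis mset_map)
  then show ?thesis
    using xs by auto
qed

text \<open>The cocore phase comes first. The core phase then runs on the remaining handles only,
  with the handle carrying the gcd as a bystander, so the gcd is preserved. The case distinctions
  account for zero and one handle, where terms of the normal form are absent.\<close>

lemma (in group) deformable_normal_form:
  assumes H: "subgroup H G" and "fst ` set_mset M \<subseteq> H"
  shows "\<exists>c k l. c ` {1..size M} \<subseteq> H \<and>
           deformable G P M (image_mset (\<lambda>j. if j = 1 then (c j, Gcd ((fst \<circ> snd) ` set_mset M), k)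
                                            else if j = 2 then (c j, 0, l) else (c j, 0, 0))
                              (mset_set {1..size M}))"
proof (cases "M = {#}")
  case True
  then show ?thesis by (auto intro: deformed_refl)
next
  case False
  let ?g = "Gcd ((fst \<circ> snd) ` set_mset M)"
  obtain a n R where aR: "a \<in> H" "fst ` set_mset R \<subseteq> H" "size M = Suc (size R)"
    "deformable G P M (add_mset (a, ?g, n) (image_mset (\<lambda>(b, k). (b, 0, k)) R))"
    using deformable_Gcd_cocores[OF H False assms(2)] by blast
  show ?thesis
  proof (cases "R = {#}")
    case True
    then show ?thesis using aR
      by (intro exI[of _ "\<lambda>_. a"] exI[of _ n]) auto
  next
    case False
    obtain b l S where bS: "b \<in> H" "set_mset S \<subseteq> H" "size R = Suc (size S)"
      "deformable G P (image_mset (\<lambda>(b, k). (b, 0, k)) R)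
         (add_mset (b, 0, l) (image_mset (\<lambda>b. (b, 0, 0)) S))"
      using deformable_Gcd_cores[OF H False aR(2)] by blast
    obtain c where c: "S = image_mset c (mset_set {3..<3 + size S})"
      using multiset_indexed_by_interval by blast
    \<comment> \<open>Indices 1 and 2 go to the handles singled out by the two phases;
      \<open>c\<close> is taken only from 3 on.\<close>
    define c' where "c' = c(1 := a, 2 := b)"
    let ?I = "{3..<3 + size S}"
    have I: "{1..size M} = insert 1 (insert 2 ?I)"
      using aR(3) bS(3) by auto
    have cI: "c j \<in> H" if "j \<in> ?I" for j
      using bS(2) that by (subst (asm) c) auto
    have "deformable G P M (add_mset (a, ?g, n)
        (add_mset (b, 0, l) (image_mset (\<lambda>b. (b, 0, 0)) S)))"
      using deformed_trans[OF aR(4)] deformable_add[OF bS(4), of "{#(a, ?g, n)#}"] by simp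
    \<comment> \<open>On indices from 3 on both tests fail and \<open>c'\<close> agrees with
      \<open>c\<close>, so one function describes all terms, including the first two.\<close>
    also have "image_mset (\<lambda>b. (b, 0, 0)) S = image_mset (\<lambda>j. if j = 1 then (c' j, ?g, n)
        else if j = 2 then (c' j, 0, l) else (c' j, 0, 0)) (mset_set ?I)"
      by (subst c) (auto simp: multiset.map_comp c'_def intro!: image_mset_cong)
    finally show ?thesis
      using aR(1) bS(1) cI unfolding I
      by (intro exI[of _ c'] exI[of _ n] exI[of _ l]) (auto simp: c'_def)
  qed
qed

section \<open>Application to the knot group and its peripheral subgroup\<close>

lemma sum_singleton_mset: "finite A \<Longrightarrow> (\<Sum>j\<in>A. {#f j#}) = image_mset f (mset_set A)"
  by (induction A rule: finite_induct) auto

theorem theorem1p2: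
  fixes F0 N :: "(real^4) set" and x :: "real^4" and g :: nat
    and h :: "nat \<Rightarrow> (real \<Rightarrow> real^4) set set"
    and a :: "nat \<Rightarrow> (real \<Rightarrow> real^4) set"
    and m n :: "nat \<Rightarrow> int"
  defines "G \<equiv> knot_group N x" and "P \<equiv> peripheral_subgroup N x"
  assumes "surface_knot F0" and "tubular_neighbourhood F0 N" and "x \<in> frontier N"
    and "\<And>j. j \<in> {1..g} \<Longrightarrow> h j \<in> double_cosets G P"
    and "\<And>j. j \<in> {1..g} \<Longrightarrow> a j \<in> h j"
  shows "\<exists>h' n1' n2'.
    (\<forall>j\<in>{1..g}. h' j \<in> handles_generated_by G P (a ` {1..g})) \<and>
    deformed_by_handle_moves G P
      (\<Sum>j=1..g. {#(h j, m j, n j)#})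
      (\<Sum>j=1..g. {#if j = 1 then (h' j, Gcd (m ` {1..g}), n1')
                   else if j = 2 then (h' j, 0, n2')
                   else (h' j, 0, 0)#})"
proof -
  have x: "x \<in> - interior N"
    using \<open>x \<in> frontier N\<close> by (simp add: frontier_def)
  interpret group G
    unfolding G_def knot_group_def by (rule group_fundamental_group[OF x])
  have P: "subgroup P G"
    unfolding P_def G_def knot_group_def peripheral_subgroup_def
    by (rule subgroup_loops_of_subset) (use assms in \<open>auto simp: frontier_def\<close>)
  have a: "a j \<in> carrier G" "double_coset G P (a j) = h j" if "j \<in> {1..g}" for j
    using double_coset_eqI[OF P assms(6)[OF that] assms(7)[OF that]] by auto
  let ?H = "generate G (a ` {1..g})"
  have H: "subgroup ?H G"
    by (rule generate_is_subgroup) (use a in auto)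
  \<comment> \<open>The given 1-handles with their chosen loops, so that membership in the generated
    subgroup can be followed through the moves.\<close>
  define M where "M = image_mset (\<lambda>j. (a j, m j, n j)) (mset_set {1..g})"
  have size: "size M = g" and fst: "fst ` set_mset M \<subseteq> ?H"
    and cocores: "(fst \<circ> snd) ` set_mset M = m ` {1..g}"
    by (auto simp: M_def image_image intro: generate.incl)
  obtain c k l where c: "c ` {1..g} \<subseteq> ?H" and def: "deformable G P M
      (image_mset (\<lambda>j. if j = 1 then (c j, Gcd (m ` {1..g}), k)
                      else if j = 2 then (c j, 0, l) else (c j, 0, 0)) (mset_set {1..g}))"
    using deformable_normal_form[OF H fst, of P] unfolding size cocores by blast
  have start: "handles_of G P M = (\<Sum>j=1..g. {#(h j, m j, n j)#})"
    using a(2) by (auto simp: handles_of_def M_def sum_singleton_mset multiset.map_comp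
        intro!: image_mset_cong)
  have finish: "handles_of G P
      (image_mset (\<lambda>j. if j = 1 then (c j, Gcd (m ` {1..g}), k)
                      else if j = 2 then (c j, 0, l) else (c j, 0, 0)) (mset_set {1..g}))
    = (\<Sum>j=1..g. {#if j = 1 then (double_coset G P (c j), Gcd (m ` {1..g}), k)
                   else if j = 2 then (double_coset G P (c j), 0, l)
                   else (double_coset G P (c j), 0, 0)#})"
    unfolding handles_of_def multiset.map_comp sum_singleton_mset[OF finite_atLeastAtMost]
    by (rule image_mset_cong) simp
  have "\<forall>j\<in>{1..g}. double_coset G P (c j) \<in> handles_generated_by G P (a ` {1..g})"
    using c unfolding handles_generated_by_def by blast
  then show ?thesis
    using def unfolding start finish
    by (intro exI[of _ "\<lambda>j. double_coset G P (c j)"] exI[of _ k] exI[of _ l] conjI)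
qed

end
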